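(* Let $k$ be a positive integer and let $A,B\in\mathcal{B}(\mathcal{H})$ be $k$-quasihyponormal operators. Then the following hold: (1) If $A^*A^kB=BA^*A^k$ and $A^jB^j=(AB)^j$ for $j\in\{k,k+1\}$, then $AB$ is $k$-quasihyponormal. (2) If $B^*B^kA=AB^*B^k$ and $B^jA^j=(BA)^j$ for $j\in\{k,k+1\}$, then $BA$ is $k$-quasihyponormal.
   Context: $\mathcal{H}$ is a complex Hilbert space and $\mathcal{B}(\mathcal{H})$ is the set of bounded linear operators on $\mathcal{H}$. For a positive integer $k$, $T\in\mathcal{B}(\mathcal{H})$ is $k$-quasihyponormal if $T^{*k}(T^*T-TT^* )T^k\geq 0$, equivalently $\|T^*T^kx\|\leq\|T^{k+1}x\|$ for all $x\in\mathcal{H}$. *)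

theory Defs
  imports "HOL-Analysis.Analysis"
begin

section \<open>Complex Hilbert spaces\<close>

text \<open>
  The classes follow the pattern of \<^class>\<open>real_vector\<close>, \<^class>\<open>real_inner\<close> and
  \<^class>\<open>banach\<close>, with complex scalars. The inner product is linear in the first
  argument and conjugate-linear in the second. The real structure inherited from the library
  is the restriction of scalars. The topology comes from \<^class>\<open>real_normed_vector\<close>, whose norm
  is required to be the one induced by the inner product; the norm axioms of that class (such as
  the triangle inequality) follow from those of the inner product, so they are no restriction.
\<close>

class complex_vector = real_vector +
  fixes scaleC :: "complex \<Rightarrow> 'a \<Rightarrow> 'a"  (infixr \<open>*\<^sub>C\<close> 75)
  assumes scaleC_add_right: "a *\<^sub>C (x + y) = a *\<^sub>C x + a *\<^sub>C y"
    and scaleC_add_left: "(a + b) *\<^sub>C x = a *\<^sub>C x + b *\<^sub>C x"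
    and scaleC_scaleC: "a *\<^sub>C (b *\<^sub>C x) = (a * b) *\<^sub>C x"
    and scaleC_one: "1 *\<^sub>C x = x"
    and scaleR_scaleC: "r *\<^sub>R x = complex_of_real r *\<^sub>C x"

class complex_inner = complex_vector + real_normed_vector +
  fixes cinner :: "'a \<Rightarrow> 'a \<Rightarrow> complex"
  assumes cinner_commute: "cinner x y = cnj (cinner y x)"
    and cinner_add_left: "cinner (x + y) z = cinner x z + cinner y z"
    and cinner_scaleC_left: "cinner (c *\<^sub>C x) y = c * cinner x y"
    and cinner_ge_zero: "0 \<le> Re (cinner x x)"
    and cinner_eq_zero_iff: "cinner x x = 0 \<longleftrightarrow> x = 0"
    and norm_eq_sqrt_cinner: "norm x = sqrt (Re (cinner x x))"

lemma cinner_add_right: "cinner x (y + z) = cinner x y + cinner x z"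
  unfolding cinner_commute [of x] by (simp add: cinner_add_left)

lemma cinner_scaleC_right: "cinner x (c *\<^sub>C y) = cnj c * cinner x y"
  unfolding cinner_commute [of x] by (simp add: cinner_scaleC_left)

lemma cinner_scaleR_left: "cinner (r *\<^sub>R x) y = complex_of_real r * cinner x y"
  by (simp add: scaleR_scaleC cinner_scaleC_left)

lemma cinner_scaleR_right: "cinner x (r *\<^sub>R y) = complex_of_real r * cinner x y"
  by (simp add: scaleR_scaleC cinner_scaleC_right)

lemma cinner_zero_left [simp]: "cinner 0 x = 0"
  using cinner_add_left [of 0 0 x] by simp

lemma cinner_zero_right [simp]: "cinner x 0 = 0"
  using cinner_add_right [of x 0 0] by simp

lemma cinner_minus_left: "cinner (- x) y = - cinner x y"
  using minus_unique [of "cinner x y" "cinner (- x) y"] cinner_add_left [of x "- x" y] by simp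

lemma cinner_minus_right: "cinner x (- y) = - cinner x y"
  using minus_unique [of "cinner x y" "cinner x (- y)"] cinner_add_right [of x y "- y"] by simp

lemma cinner_diff_left: "cinner (x - y) z = cinner x z - cinner y z"
  using cinner_add_left [of x "- y" z] by (simp add: cinner_minus_left)

lemma cinner_diff_right: "cinner x (y - z) = cinner x y - cinner x z"
  using cinner_add_right [of x y "- z"] by (simp add: cinner_minus_right)

lemma Im_cinner_self [simp]: "Im (cinner x x) = 0"
  using arg_cong [OF cinner_commute [of x x], of Im] by simp

lemma power2_norm_eq_cinner: "(norm x)\<^sup>2 = Re (cinner x x)"
  by (simp add: norm_eq_sqrt_cinner cinner_ge_zero)

lemma Re_cinner_commute: "Re (cinner x y) = Re (cinner y x)"
  unfolding cinner_commute [of x y] by simp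

lemma Re_Cauchy_Schwarz: "(Re (cinner x y))\<^sup>2 \<le> Re (cinner x x) * Re (cinner y y)"
proof (cases "y = 0")
  case True
  then show ?thesis by simp
next
  case False
  have y: "Re (cinner y y) > 0"
  proof -
    have "Re (cinner y y) \<noteq> 0"
      using False cinner_eq_zero_iff [of y] Im_cinner_self [of y] by (simp add: complex_eq_iff)
    then show ?thesis using cinner_ge_zero [of y] by simp
  qed
  define r where "r = Re (cinner x y) / Re (cinner y y)"
  have "0 \<le> Re (cinner (x - r *\<^sub>R y) (x - r *\<^sub>R y))"
    by (rule cinner_ge_zero)
  also have "\<dots> = Re (cinner x x) - 2 * r * Re (cinner x y) + r * r * Re (cinner y y)"
    by (simp add: cinner_diff_left cinner_diff_right cinner_scaleR_left cinner_scaleR_right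
        Re_cinner_commute [of y x] algebra_simps)
  also have "\<dots> = Re (cinner x x) - (Re (cinner x y))\<^sup>2 / Re (cinner y y)"
    using y by (simp add: r_def power2_eq_square field_simps)
  finally show ?thesis
    using y by (simp add: field_simps)
qed

lemma Re_cinner_le_norm: "\<bar>Re (cinner x y)\<bar> \<le> norm x * norm y"
proof (rule power2_le_imp_le)
  show "\<bar>Re (cinner x y)\<bar>\<^sup>2 \<le> (norm x * norm y)\<^sup>2"
    using Re_Cauchy_Schwarz [of x y] by (simp add: power_mult_distrib power2_norm_eq_cinner)
  show "0 \<le> norm x * norm y"
    by (simp add: norm_eq_sqrt_cinner cinner_ge_zero)
qed

class chilbert_space = complex_inner + complete_space
begin

subclass banach ..

end

instantiation complex :: chilbert_space
begin

definition scaleC_complex :: "complex \<Rightarrow> complex \<Rightarrow> complex"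
  where "scaleC_complex a x = a * x"

definition cinner_complex :: "complex \<Rightarrow> complex \<Rightarrow> complex"
  where "cinner_complex x y = x * cnj y"

instance
proof
  fix a b x y z :: complex and r :: real
  show "a *\<^sub>C (x + y) = a *\<^sub>C x + a *\<^sub>C y" "(a + b) *\<^sub>C x = a *\<^sub>C x + b *\<^sub>C x"
    "a *\<^sub>C (b *\<^sub>C x) = (a * b) *\<^sub>C x" "1 *\<^sub>C x = x" "r *\<^sub>R x = complex_of_real r *\<^sub>C x"
    by (simp_all add: scaleC_complex_def distrib_left distrib_right mult.assoc scaleR_conv_of_real)
  show "cinner x y = cnj (cinner y x)" "cinner (x + y) z = cinner x z + cinner y z"
    "cinner (a *\<^sub>C x) y = a * cinner x y" "0 \<le> Re (cinner x x)" "cinner x x = 0 \<longleftrightarrow> x = 0"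
    by (simp_all add: cinner_complex_def scaleC_complex_def distrib_right)
  show "norm x = sqrt (Re (cinner x x))"
    by (simp add: cinner_complex_def cmod_def power2_eq_square)
qed

end


section \<open>Bounded operators, adjoint, positivity\<close>

definition bounded_clinear :: "('a::complex_inner \<Rightarrow> 'b::complex_inner) \<Rightarrow> bool"
  where "bounded_clinear T \<longleftrightarrow> bounded_linear T \<and> (\<forall>c x. T (c *\<^sub>C x) = c *\<^sub>C T x)"

definition cadjoint :: "('a::chilbert_space \<Rightarrow> 'a) \<Rightarrow> 'a \<Rightarrow> 'a"
  where "cadjoint T =
    (THE S. bounded_clinear S \<and> (\<forall>x y. cinner (T x) y = cinner x (S y)))"

definition positive_op :: "('a::chilbert_space \<Rightarrow> 'a) \<Rightarrow> bool"
  where "positive_op P \<longleftrightarrow>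
    bounded_clinear P \<and> (\<forall>x. cinner (P x) x \<in> \<real> \<and> 0 \<le> Re (cinner (P x) x))"

definition quasihyponormal :: "nat \<Rightarrow> ('a::chilbert_space \<Rightarrow> 'a) \<Rightarrow> bool"
  where "quasihyponormal k T \<longleftrightarrow> bounded_clinear T \<and>
    positive_op ((cadjoint T ^^ k) \<circ> (\<lambda>x. (cadjoint T \<circ> T) x - (T \<circ> cadjoint T) x) \<circ> (T ^^ k))"


section \<open>Existence and uniqueness of the adjoint\<close>

lemma parallelogram_complex_inner:
  fixes x y :: "'a::complex_inner"
  shows "(norm (x + y))\<^sup>2 + (norm (x - y))\<^sup>2 = 2 * (norm x)\<^sup>2 + 2 * (norm y)\<^sup>2"
  by (simp add: power2_norm_eq_cinner cinner_add_left cinner_add_right cinner_diff_left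
      cinner_diff_right)

lemma Riesz_real:
  fixes g :: "'a::chilbert_space \<Rightarrow> real"
  assumes g: "bounded_linear g"
  obtains v where "\<And>x. g x = Re (cinner x v)"
proof -
  interpret g: bounded_linear g by fact
  define p where "p x = (norm x)\<^sup>2 - 2 * g x" for x
  define m where "m = Inf (range p)"
  obtain K where K: "\<And>x. norm (g x) \<le> norm x * K"
    using g.bounded by blast
  have "- K\<^sup>2 \<le> p x" for x
  proof -
    have "g x \<le> norm x * K" using K [of x] by simp
    moreover have "0 \<le> (norm x - K)\<^sup>2" by simp
    ultimately show ?thesis by (simp add: p_def power2_diff)
  qed
  then have bdd: "bdd_below (range p)" by (auto simp: bdd_below_def)
  have m_le: "m \<le> p x" for x
    unfolding m_def using bdd by (simp add: cInf_lower)
  have near: "\<exists>x. p x < m + e" if "e > 0" for e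
  proof (rule ccontr)
    assume "\<nexists>x. p x < m + e"
    then have "m + e \<le> Inf (range p)" by (intro cInf_greatest) (auto simp: not_less)
    with that show False by (simp add: m_def)
  qed
  have "\<forall>n. \<exists>x. p x < m + inverse (real (Suc n))"
    by (intro allI near) simp
  then obtain X where X: "\<And>n. p (X n) < m + inverse (real (Suc n))" by metis
  have mid: "(norm (x - y))\<^sup>2 \<le> 2 * (p x - m) + 2 * (p y - m)" for x y
  proof -
    have "p ((1/2) *\<^sub>R (x + y)) = (norm (x + y))\<^sup>2 / 4 - g x - g y"
      by (simp add: p_def g.scaleR g.add power_divide add_divide_distrib)
    then show ?thesis
      using m_le [of "(1/2) *\<^sub>R (x + y)"] parallelogram_complex_inner [of x y]
      by (simp add: p_def)
  qed
  have "Cauchy X"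
  proof (rule CauchyI)
    fix e :: real assume e: "0 < e"
    then obtain N where N: "inverse (real (Suc N)) < e\<^sup>2 / 4"
      using reals_Archimedean [of "e\<^sup>2 / 4"] by auto
    have small: "p (X n) - m < e\<^sup>2 / 4" if "n \<ge> N" for n
    proof -
      have "inverse (real (Suc n)) \<le> inverse (real (Suc N))"
        using that by (intro le_imp_inverse_le) auto
      then show ?thesis using X [of n] N by linarith
    qed
    have "norm (X i - X j) < e" if "i \<ge> N" "j \<ge> N" for i j
    proof (rule power2_less_imp_less)
      have "2 * (p (X i) - m) + 2 * (p (X j) - m) < 2 * (e\<^sup>2 / 4) + 2 * (e\<^sup>2 / 4)"
        using small [OF that(1)] small [OF that(2)] by (intro add_strict_mono) simp_all
      then show "(norm (X i - X j))\<^sup>2 < e\<^sup>2"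
        using mid [of "X i" "X j"] by simp
    qed (use e in simp)
    then show "\<exists>M. \<forall>i\<ge>M. \<forall>j\<ge>M. norm (X i - X j) < e" by blast
  qed
  then obtain v where v: "X \<longlonglongrightarrow> v"
    using Cauchy_convergent convergent_def by blast
  have "(\<lambda>n. p (X n)) \<longlonglongrightarrow> p v"
    unfolding p_def by (intro tendsto_intros g.tendsto v)
  moreover have "(\<lambda>n. m + inverse (real (Suc n))) \<longlonglongrightarrow> m + 0"
    by (intro tendsto_intros LIMSEQ_inverse_real_of_nat)
  ultimately have "p v \<le> m + 0"
    by (rule LIMSEQ_le) (use X less_imp_le in blast)
  then have min: "p v \<le> p x" for x
    using m_le [of x] by simp
  have "g x = Re (cinner x v)" for x
  proof (rule ccontr)
    assume ne: "g x \<noteq> Re (cinner x v)"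
    define d where "d = Re (cinner x v) - g x"
    have quad: "0 \<le> t\<^sup>2 * (norm x)\<^sup>2 + 2 * t * d" for t :: real
    proof -
      have "(norm (v + t *\<^sub>R x))\<^sup>2 = (norm v)\<^sup>2 + 2 * t * Re (cinner x v) + t\<^sup>2 * (norm x)\<^sup>2"
        unfolding power2_norm_eq_cinner
        by (simp add: cinner_add_left cinner_add_right cinner_scaleR_left
            cinner_scaleR_right Re_cinner_commute [of v x] power2_eq_square distrib_left mult.assoc)
      then show ?thesis
        using min [of "v + t *\<^sub>R x"] by (simp add: p_def g.add g.scaleR d_def algebra_simps)
    qed
    define N where "N = (norm x)\<^sup>2 + 1"
    have N: "N > 0" unfolding N_def by (simp add: add_nonneg_pos)
    have "0 \<le> (- d / N)\<^sup>2 * (norm x)\<^sup>2 + 2 * (- d / N) * d" by (rule quad)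
    also have "\<dots> \<le> (- d / N)\<^sup>2 * N + 2 * (- d / N) * d"
      unfolding N_def by (intro add_right_mono mult_left_mono) auto
    also have "\<dots> = - (d\<^sup>2 / N)"
      using N by (simp add: power2_eq_square)
    finally have "d\<^sup>2 / N \<le> 0" by simp
    moreover have "d\<^sup>2 / N > 0" using ne N by (simp add: d_def)
    ultimately show False by simp
  qed
  then show thesis by (rule that)
qed

lemma bounded_clinearD:
  assumes "bounded_clinear T"
  shows "bounded_linear T" "T (x + y) = T x + T y" "T (c *\<^sub>C x) = c *\<^sub>C T x"
  using assms by (auto simp: bounded_clinear_def bounded_linear.linear linear_add)

lemma cinner_eqI:
  fixes u v :: "'a::complex_inner"
  assumes "\<And>x. cinner x u = cinner x v"
  shows "u = v"
proof -
  have "cinner (u - v) (u - v) = 0"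
    using assms [of "u - v"] by (simp add: cinner_diff_right)
  then show ?thesis by (simp add: cinner_eq_zero_iff)
qed

lemma cadjoint_ex:
  fixes T :: "'a::chilbert_space \<Rightarrow> 'a"
  assumes T: "bounded_clinear T"
  shows "\<exists>S. bounded_clinear S \<and> (\<forall>x y. cinner (T x) y = cinner x (S y))"
proof -
  interpret T: bounded_linear T using T by (rule bounded_clinearD)
  obtain K where K0: "K > 0" and K: "\<And>x. norm (T x) \<le> norm x * K"
    using T.pos_bounded by blast
  have "\<exists>v. \<forall>x. cinner (T x) y = cinner x v" for y
  proof -
    have "bounded_linear (\<lambda>x. Re (cinner (T x) y))"
    proof (rule bounded_linear_intro)
      fix x z and r :: real
      show "Re (cinner (T (x + z)) y) = Re (cinner (T x) y) + Re (cinner (T z) y)"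
        by (simp add: T.add cinner_add_left)
      show "Re (cinner (T (r *\<^sub>R x)) y) = r *\<^sub>R Re (cinner (T x) y)"
        by (simp add: T.scaleR cinner_scaleR_left)
      have "\<bar>Re (cinner (T x) y)\<bar> \<le> norm (T x) * norm y"
        by (rule Re_cinner_le_norm)
      also have "\<dots> \<le> (norm x * K) * norm y"
        by (intro mult_right_mono K) simp
      finally show "norm (Re (cinner (T x) y)) \<le> norm x * (K * norm y)"
        by (simp add: mult.assoc)
    qed
    then obtain v where v: "\<And>x. Re (cinner (T x) y) = Re (cinner x v)"
      using Riesz_real [of "\<lambda>x. Re (cinner (T x) y)"] by blast
    have "cinner (T x) y = cinner x v" for x
      using v [of x] v [of "\<i> *\<^sub>C x"]
      by (simp add: bounded_clinearD [OF T] cinner_scaleC_left complex_eq_iff)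
    then show ?thesis by blast
  qed
  then obtain S where S: "\<And>x y. cinner (T x) y = cinner x (S y)" by metis
  have add: "S (y + z) = S y + S z" for y z
    by (rule cinner_eqI) (simp add: S [symmetric] cinner_add_right)
  have scale: "S (c *\<^sub>C y) = c *\<^sub>C S y" for c y
    by (rule cinner_eqI) (simp add: S [symmetric] cinner_scaleC_right)
  have bound: "norm (S y) \<le> norm y * K" for y
  proof (cases "S y = 0")
    case True
    then show ?thesis using K0 by simp
  next
    case False
    have "norm (S y) * norm (S y) = Re (cinner (T (S y)) y)"
      by (simp add: S power2_norm_eq_cinner power2_eq_square [symmetric])
    also have "\<dots> \<le> norm (T (S y)) * norm y"
      using Re_cinner_le_norm [of "T (S y)" y] by simp
    also have "\<dots> \<le> (norm (S y) * K) * norm y"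
      by (intro mult_right_mono K) simp
    finally have "norm (S y) * norm (S y) \<le> norm (S y) * (norm y * K)"
      by (simp add: ac_simps)
    then show ?thesis using False by simp
  qed
  have "bounded_linear S"
    by (rule bounded_linear_intro [where K = K]) (simp_all add: add bound scaleR_scaleC scale)
  then have "bounded_clinear S" by (simp add: bounded_clinear_def scale)
  with S show ?thesis by blast
qed

lemma cadjoint:
  fixes T :: "'a::chilbert_space \<Rightarrow> 'a"
  assumes "bounded_clinear T"
  shows bounded_clinear_cadjoint: "bounded_clinear (cadjoint T)"
    and cinner_cadjoint: "cinner (T x) y = cinner x (cadjoint T y)"
proof -
  have "\<exists>!S. bounded_clinear S \<and> (\<forall>x y. cinner (T x) y = cinner x (S y))"
  proof (rule ex_ex1I [OF cadjoint_ex [OF assms]])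
    fix S S' :: "'a \<Rightarrow> 'a"
    assume S: "bounded_clinear S \<and> (\<forall>x y. cinner (T x) y = cinner x (S y))"
      and S': "bounded_clinear S' \<and> (\<forall>x y. cinner (T x) y = cinner x (S' y))"
    have "S y = S' y" for y
      by (rule cinner_eqI) (use S S' in metis)
    then show "S = S'" by (rule ext)
  qed
  from theI' [OF this] show "bounded_clinear (cadjoint T)"
    and "cinner (T x) y = cinner x (cadjoint T y)"
    unfolding cadjoint_def [symmetric] by blast+
qed

end

theory Submission
  imports Defs
begin

text \<open>
  Positivity of \<open>T\<^sup>*\<^sup>k (T\<^sup>*T - TT\<^sup>*) T\<^sup>k\<close> only says something about its quadratic form, whose
  value at \<open>x\<close> is \<open>\<parallel>T\<^sup>k\<^sup>+\<^sup>1 x\<parallel>\<^sup>2 - \<parallel>T\<^sup>* T\<^sup>k x\<parallel>\<^sup>2\<close>. So \<open>T\<close> is \<open>k\<close>-quasihyponormal exactly when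
  \<open>\<parallel>T\<^sup>* T\<^sup>k x\<parallel> \<le> \<parallel>T\<^sup>k\<^sup>+\<^sup>1 x\<parallel>\<close> for all \<open>x\<close> (lemma \<open>quasihyponormal_iff_norm\<close>).

  In this form the bounds for \<open>A\<close> and \<open>B\<close> can be chained. Put \<open>C = A\<^sup>* A\<^sup>k\<close>, which commutes with
  \<open>B\<close> and hence with its powers. The hypothesis on \<open>j = k\<close> splits \<open>(AB)\<^sup>k\<close>, so that
  \<open>(AB)\<^sup>* (AB)\<^sup>k x = B\<^sup>* C B\<^sup>k x = B\<^sup>* B\<^sup>k (C x)\<close>. The bound for \<open>B\<close> at the vector \<open>C x\<close> replaces this
  by \<open>B\<^sup>k\<^sup>+\<^sup>1 C x = A\<^sup>* A\<^sup>k (B\<^sup>k\<^sup>+\<^sup>1 x)\<close>, and the bound for \<open>A\<close> at \<open>B\<^sup>k\<^sup>+\<^sup>1 x\<close> replaces that by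
  \<open>A\<^sup>k\<^sup>+\<^sup>1 B\<^sup>k\<^sup>+\<^sup>1 x\<close>, which is \<open>(AB)\<^sup>k\<^sup>+\<^sup>1 x\<close> by the hypothesis on \<open>j = k + 1\<close>. The second part is the
  first with \<open>A\<close> and \<open>B\<close> exchanged.
\<close>

lemma bounded_clinear_compose:
  assumes "bounded_clinear S" and "bounded_clinear T"
  shows "bounded_clinear (S \<circ> T)"
  using assms bounded_linear_compose [of S T] by (simp add: bounded_clinear_def o_def)

lemma bounded_clinear_funpow:
  fixes T :: "'a::complex_inner \<Rightarrow> 'a"
  assumes "bounded_clinear T"
  shows "bounded_clinear (T ^^ n)"
proof (induction n)
  case 0
  show ?case using bounded_linear_ident by (simp add: bounded_clinear_def id_def)
next
  case (Suc n)
  then show ?case using bounded_clinear_compose [OF assms, of "T ^^ n"] by (simp add: o_def)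
qed

lemma bounded_clinear_diff:
  assumes "bounded_clinear S" and "bounded_clinear T"
  shows "bounded_clinear (\<lambda>x. S x - T x)"
proof -
  have "c *\<^sub>C y - c *\<^sub>C z = c *\<^sub>C (y - z)" for c and y z :: 'b
    using scaleC_add_right [of c "y - z" z] by simp
  then show ?thesis
    using assms by (simp add: bounded_clinear_def bounded_linear_sub)
qed

lemma cinner_cadjoint_left:
  assumes "bounded_clinear T"
  shows "cinner (cadjoint T x) y = cinner x (T y)"
  using cinner_cadjoint [OF assms, of y x] by (metis cinner_commute)

lemma cinner_cadjoint_funpow:
  assumes "bounded_clinear T"
  shows "cinner ((cadjoint T ^^ n) x) y = cinner x ((T ^^ n) y)"
  by (induction n arbitrary: y)
    (simp_all add: cinner_cadjoint_left [OF assms] funpow_swap1 [of T])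

lemma cadjoint_compose:
  assumes "bounded_clinear S" and "bounded_clinear T"
  shows "cadjoint (S \<circ> T) = cadjoint T \<circ> cadjoint S"
proof
  fix y
  show "cadjoint (S \<circ> T) y = (cadjoint T \<circ> cadjoint S) y"
  proof (rule cinner_eqI)
    fix x
    show "cinner x (cadjoint (S \<circ> T) y) = cinner x ((cadjoint T \<circ> cadjoint S) y)"
      using cinner_cadjoint [OF bounded_clinear_compose [OF assms], of x y]
      by (simp add: cinner_cadjoint [OF assms(1)] cinner_cadjoint [OF assms(2)])
  qed
qed

lemma cinner_self: "cinner x x = complex_of_real ((norm x)\<^sup>2)"
  by (simp add: complex_eq_iff power2_norm_eq_cinner)

text \<open>
  Moving the outer \<open>k\<close> adjoints, and then one adjoint in each of the two terms, to the other side of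
  the inner product turns the quadratic form into a difference of two squared norms. In particular
  it is automatically real.
\<close>

lemma quasihyponormal_iff_norm:
  assumes T: "bounded_clinear T"
  shows "quasihyponormal k T \<longleftrightarrow>
    (\<forall>x. norm (cadjoint T ((T ^^ k) x)) \<le> norm ((T ^^ (k + 1)) x))"
proof -
  let ?D = "\<lambda>x. (cadjoint T \<circ> T) x - (T \<circ> cadjoint T) x"
  let ?P = "(cadjoint T ^^ k) \<circ> ?D \<circ> (T ^^ k)"
  note T' = bounded_clinear_cadjoint [OF T]
  have P: "bounded_clinear ?P"
    by (intro bounded_clinear_compose bounded_clinear_diff bounded_clinear_funpow T T')
  have form: "cinner (?P x) x = complex_of_real
      ((norm ((T ^^ (k + 1)) x))\<^sup>2 - (norm (cadjoint T ((T ^^ k) x)))\<^sup>2)" for x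
    by (simp add: cinner_cadjoint_funpow [OF T] cinner_diff_left cinner_cadjoint_left [OF T]
        cinner_cadjoint [OF T] cinner_self)
  show ?thesis
    unfolding quasihyponormal_def positive_op_def form
    using T P by (simp add: abs_le_square_iff [symmetric])
qed

lemma funpow_commute:
  assumes "\<And>x. f (g x) = g (f x)"
  shows "f ((g ^^ n) x) = (g ^^ n) (f x)"
  by (induction n) (simp_all add: assms)

lemma quasihyponormal_compose:
  assumes A: "bounded_clinear A" and B: "bounded_clinear B"
    and qA: "quasihyponormal k A" and qB: "quasihyponormal k B"
    and comm: "cadjoint A \<circ> (A ^^ k) \<circ> B = B \<circ> cadjoint A \<circ> (A ^^ k)"
    and pow: "\<forall>j\<in>{k, k + 1}. (A ^^ j) \<circ> (B ^^ j) = (A \<circ> B) ^^ j"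
  shows "quasihyponormal k (A \<circ> B)"
proof -
  define C where "C = cadjoint A \<circ> (A ^^ k)"
  have "C (B x) = B (C x)" for x
    using fun_cong [OF comm, of x] by (simp add: C_def)
  then have CB: "C ((B ^^ n) x) = (B ^^ n) (C x)" for n x
    by (rule funpow_commute)
  have split: "((A \<circ> B) ^^ j) x = (A ^^ j) ((B ^^ j) x)" if "j \<in> {k, k + 1}" for j x
    using pow that by (metis comp_apply)
  have "norm (cadjoint (A \<circ> B) (((A \<circ> B) ^^ k) x)) \<le> norm (((A \<circ> B) ^^ (k + 1)) x)" for x
  proof -
    have "cadjoint (A \<circ> B) (((A \<circ> B) ^^ k) x) = cadjoint B (C ((B ^^ k) x))"
      by (simp add: cadjoint_compose [OF A B] split C_def)
    also have "\<dots> = cadjoint B ((B ^^ k) (C x))"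
      by (simp add: CB)
    finally have "norm (cadjoint (A \<circ> B) (((A \<circ> B) ^^ k) x))
        = norm (cadjoint B ((B ^^ k) (C x)))"
      by simp
    also have "\<dots> \<le> norm ((B ^^ (k + 1)) (C x))"
      using qB quasihyponormal_iff_norm [OF B] by blast
    also have "\<dots> = norm (cadjoint A ((A ^^ k) ((B ^^ (k + 1)) x)))"
      unfolding CB [symmetric] by (simp add: C_def)
    also have "\<dots> \<le> norm ((A ^^ (k + 1)) ((B ^^ (k + 1)) x))"
      using qA quasihyponormal_iff_norm [OF A] by blast
    also have "\<dots> = norm (((A \<circ> B) ^^ (k + 1)) x)"
      using split [of "k + 1" x] by simp
    finally show ?thesis .
  qed
  then show ?thesis
    by (simp only: quasihyponormal_iff_norm [OF bounded_clinear_compose [OF A B]]) blast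
qed

theorem proposition2p4:
  fixes A B :: "'a::chilbert_space \<Rightarrow> 'a" and k :: nat
  assumes "0 < k"
    and "bounded_clinear A" and "bounded_clinear B"
    and "quasihyponormal k A" and "quasihyponormal k B"
  shows "(cadjoint A \<circ> (A ^^ k) \<circ> B = B \<circ> cadjoint A \<circ> (A ^^ k) \<and>
          (\<forall>j\<in>{k, k + 1}. (A ^^ j) \<circ> (B ^^ j) = (A \<circ> B) ^^ j)
            \<longrightarrow> quasihyponormal k (A \<circ> B)) \<and>
         (cadjoint B \<circ> (B ^^ k) \<circ> A = A \<circ> cadjoint B \<circ> (B ^^ k) \<and>
          (\<forall>j\<in>{k, k + 1}. (B ^^ j) \<circ> (A ^^ j) = (B \<circ> A) ^^ j)
            \<longrightarrow> quasihyponormal k (B \<circ> A))"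
  using assms(2-5) quasihyponormal_compose [of A B k] quasihyponormal_compose [of B A k] by blast

end
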